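(* Let $F$, $f$, $z_1,\dots,z_n$ and $\mu(f,t)$ be as in the context, let $t\ge 1$ be real and let $\tilde f\in[f]_{\mu(f,t)}$. Then: (i) for every $i=1,\dots,n$, the open disc $\Delta_i$ of radius $\sigma(z_i,f)/(tn)$ centered at $z_i$ contains the root $z_i$ of $f$ and a corresponding root $\tilde z_i$ of $\tilde f$; (ii) for every $z\in\mathbb{C}\setminus\bigcup_{i=1}^n\Delta_i$ it holds that $|f(z)|>(n+1)\mu(f,t)$.
   Context: Let $F(x)=\sum_{i=0}^nA_ix^i\in\mathbb{R}[x]$ be a square-free polynomial of degree $n\ge 2$ with real coefficients and $|A_n|\ge1$, with complex roots $\xi_1,\dots,\xi_n$. Let $\Gamma_F:=\log_2\max_i|\xi_i|$ and let $\Gamma$ be an integer with $\Gamma_F\le\Gamma<4\log_2 n+\Gamma_F$. Define $f(x)=\sum_{i=0}^na_ix^i:=F(2^{\Gamma+1}x)/A_n$, with roots $z_1,\dots,z_n$ (so $z_i=\xi_i/2^{\Gamma+1}$ and all $|z_i|\le 1/2$). For a root $z_i$, its separation $\sigma(z_i,f)$ is the minimal distance $|z_i-z_j|$ over roots $z_j\neq z_i$. For real $t\ge1$, $\mu(f,t):=\frac1t\min_{i=1,\dots,n}\left|\frac{\sigma(z_i,f)f'(z_i)}{8n^2}\right|$. For $\mu\ge 0$, $[f]_\mu$ is the set of polynomials $\tilde f=\sum_{i=0}^n\tilde a_ix^i\in\mathbb{C}[x]$ with $|a_i-\tilde a_i|\le\mu$ for all $i$. *)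

theory Defs
  imports
    "HOL-Analysis.Analysis"
    "HOL-Computational_Algebra.Squarefree"
begin

definition scaled_poly :: "real poly \<Rightarrow> int \<Rightarrow> complex poly" where
  "scaled_poly F \<Gamma> =
     map_poly complex_of_real
       (smult (1 / lead_coeff F) (pcompose F [:0, 2 powi (\<Gamma> + 1):]))"

(* Meaningful for polynomials with at least two distinct roots, so that the minimum
   ranges over a finite nonempty set. *)
definition separation :: "complex \<Rightarrow> complex poly \<Rightarrow> real" where
  "separation z f = Min {cmod (z - w) | w. poly f w = 0 \<and> w \<noteq> z}"

definition mu :: "complex poly \<Rightarrow> real \<Rightarrow> real" where
  "mu f t = 1 / t *
     Min {cmod (of_real (separation z f) * poly (pderiv f) z / of_nat (8 * (degree f)\<^sup>2))
          | z. poly f z = 0}"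

definition approx_polys :: "complex poly \<Rightarrow> real \<Rightarrow> complex poly set" where
  "approx_polys f \<mu> =
     {g. degree g \<le> degree f \<and> (\<forall>i\<le>degree f. cmod (coeff f i - coeff g i) \<le> \<mu>)}"

end

theory Submission
  imports Defs
    "HOL-Complex_Analysis.Conformal_Mappings"
    "HOL-Computational_Algebra.Field_as_Ring"
    "HOL-Computational_Algebra.Fundamental_Theorem_Algebra"
    "HOL-Computational_Algebra.Polynomial_Factorial"
begin

text \<open>
  On the circle bounding \<open>\<Delta>\<^sub>i\<close> every factor of \<open>f w\<close> with \<open>j \<noteq> i\<close> satisfies
  \<open>\<bar>w - z\<^sub>j\<bar> \<ge> (1 - 1/n) \<bar>z\<^sub>i - z\<^sub>j\<bar>\<close>, and \<open>(1 - 1/n) ^ (n - 1) \<ge> 1/e\<close>, whence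
  \<open>\<bar>f w\<bar> \<ge> \<bar>w - z\<^sub>i\<bar> \<bar>f' z\<^sub>i\<bar> / 3 \<ge> 8 n \<mu> / 3 > (n + 1) \<mu>\<close>. As \<open>f\<close> has no zeros outside the
  discs, the maximum modulus principle for \<open>1/f\<close> carries this bound over to their complement.

  All discs lie in the unit disc, so a perturbation \<open>g\<close> of \<open>f\<close> satisfies \<open>\<bar>f - g\<bar> \<le> (n + 1) \<mu>\<close> and
  hence \<open>\<bar>g\<bar> > 2 \<mu>\<close> on the circles, whereas \<open>\<bar>g z\<^sub>i\<bar> \<le> 2 \<mu>\<close> because \<open>\<bar>z\<^sub>i\<bar> \<le> 1/2\<close>; so \<open>g\<close> has
  a root in \<open>\<Delta>\<^sub>i\<close>. The discs are disjoint and \<open>g\<close> has at most \<open>n\<close> roots, so these are all of them.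

  The roots of \<open>f\<close> are simple because a squarefree real polynomial is coprime to its derivative, and
  the Bezout identity witnessing this persists over the complex numbers.
\<close>

section \<open>Squarefree polynomials and simple roots\<close>

lemma squarefree_imp_coprime_pderiv:
  fixes p :: "'a :: {field_char_0, field_gcd} poly"
  assumes "squarefree p"
  shows "coprime p (pderiv p)"
proof (rule ccontr)
  assume "\<not> coprime p (pderiv p)"
  then have "\<not> is_unit (gcd p (pderiv p))"
    using is_unit_gcd by blast
  moreover have "gcd p (pderiv p) \<noteq> 0"
    using assms by auto
  ultimately obtain q where "q dvd p" "q dvd pderiv p" "prime q"
    using prime_divisor_exists[of "gcd p (pderiv p)"] by auto
  from \<open>q dvd p\<close> obtain r where p: "p = q * r" ..
  have "q dvd pderiv q * r"
    using \<open>q dvd pderiv p\<close> by (simp add: p pderiv_mult dvd_add_right_iff mult.commute)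
  moreover have "\<not> q dvd pderiv q"
    using \<open>prime q\<close> by (metis dvd_pderiv_iff is_unit_iff_degree not_prime_0 not_prime_unit)
  ultimately have "q dvd r"
    using \<open>prime q\<close> by (simp add: prime_dvd_mult_iff)
  then have "q\<^sup>2 dvd p"
    by (simp add: p power2_eq_square mult_dvd_mono)
  with assms have "is_unit q"
    by (rule squarefreeD)
  with \<open>prime q\<close> show False
    by simp
qed

lemma map_poly_of_real_add:
  "map_poly of_real (p + q) = (map_poly of_real p + map_poly of_real q :: 'a :: real_field poly)"
  by (intro poly_eqI) (simp add: coeff_map_poly)

lemma map_poly_of_real_mult:
  "map_poly of_real (p * q) = (map_poly of_real p * map_poly of_real q :: 'a :: real_field poly)"
  by (intro poly_eqI) (simp add: coeff_map_poly coeff_mult)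

lemma pderiv_map_poly_of_real:
  "pderiv (map_poly of_real p :: 'a :: real_field poly) = map_poly of_real (pderiv p)"
  by (intro poly_eqI) (simp add: coeff_map_poly coeff_pderiv)

lemma squarefree_imp_rsquarefree_map_poly_of_real:
  assumes "squarefree p"
  shows "rsquarefree (map_poly of_real p :: 'a :: real_field poly)"
  unfolding rsquarefree_roots
proof (intro allI notI)
  fix x :: 'a
  assume x: "poly (map_poly of_real p) x = 0 \<and> poly (pderiv (map_poly of_real p)) x = 0"
  obtain a b where "a * p + b * pderiv p = 1"
    using squarefree_imp_coprime_pderiv[OF assms] bezout_coefficients_fst_snd[of p "pderiv p"]
    by (metis coprime_iff_gcd_eq_1)
  then have "map_poly of_real a * map_poly of_real p
      + map_poly of_real b * pderiv (map_poly of_real p) = (1 :: 'a poly)"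
    by (simp flip: map_poly_of_real_add map_poly_of_real_mult add: pderiv_map_poly_of_real)
  from arg_cong[OF this, of "\<lambda>q. poly q x"] x show False
    by simp
qed

lemma rsquarefree_smult_pcompose_linear:
  fixes p :: "'a :: field_char_0 poly"
  assumes "rsquarefree p" "a \<noteq> 0" "c \<noteq> 0"
  shows "rsquarefree (smult a (pcompose p [:b, c:]))"
  using assms unfolding rsquarefree_roots
  by (simp add: pderiv_smult pderiv_pcompose pderiv_pCons poly_pcompose)

lemma poly_rsquarefree_eq_prod:
  fixes p :: "complex poly"
  assumes "rsquarefree p"
  shows "poly p w = lead_coeff p * (\<Prod>z | poly p z = 0. w - z)"
  by (subst complex_poly_decompose_rsquarefree[OF assms, symmetric]) (simp add: poly_prod)

lemma card_roots_rsquarefree: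
  fixes p :: "complex poly"
  assumes "rsquarefree p"
  shows "card {z. poly p z = 0} = degree p"
proof -
  have "degree p = degree (smult (lead_coeff p) (\<Prod>z | poly p z = 0. [:- z, 1:]))"
    by (simp only: complex_poly_decompose_rsquarefree[OF assms])
  also have "\<dots> = card {z. poly p z = 0}"
    using assms by (simp add: rsquarefree_def degree_prod_eq_sum_degree)
  finally show ?thesis ..
qed

lemma poly_pderiv_rsquarefree_root:
  fixes p :: "complex poly"
  assumes "rsquarefree p" "poly p z = 0"
  shows "poly (pderiv p) z = lead_coeff p * (\<Prod>w \<in> {w. poly p w = 0} - {z}. z - w)"
proof -
  define q where "q = smult (lead_coeff p) (\<Prod>w \<in> {w. poly p w = 0} - {z}. [:- w, 1:])"
  have "finite {w. poly p w = 0}"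
    using assms(1) by (intro poly_roots_finite) (simp add: rsquarefree_def)
  then have "p = [:- z, 1:] * q"
    using assms(2) prod.remove[of "{w. poly p w = 0}" z "\<lambda>w. [:- w, 1:]"]
      complex_poly_decompose_rsquarefree[OF assms(1)] by (simp add: q_def)
  then have "poly (pderiv p) z = poly q z"
    by (simp only: pderiv_mult) (simp add: pderiv_pCons)
  then show ?thesis
    by (simp add: q_def poly_prod)
qed

section \<open>Root separation\<close>

lemma finite_root_distances:
  assumes "p \<noteq> 0"
  shows "finite {cmod (z - w) | w. poly p w = 0 \<and> w \<noteq> z}"
  using poly_roots_finite[OF assms] by simp

lemma separation_le:
  assumes "p \<noteq> 0" "poly p w = 0" "w \<noteq> z"
  shows "separation z p \<le> cmod (z - w)"
  unfolding separation_def using assms by (intro Min_le finite_root_distances) auto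

lemma separation_pos:
  assumes "p \<noteq> 0" "poly p w = 0" "w \<noteq> z"
  shows "separation z p > 0"
  unfolding separation_def using assms by (subst Min_gr_iff) (auto simp: finite_root_distances)

lemma one_minus_inverse_power_ge:
  assumes "n > 0"
  shows "exp (- 1) \<le> (1 - 1 / real n) ^ (n - 1)"
proof (cases "n = 1")
  case False
  define m where "m = n - 1"
  with assms False have m: "m > 0" "real n = real m + 1"
    by auto
  have "exp (- 1) = inverse (exp (1 / real m)) ^ m"
    using m by (simp add: exp_minus power_inverse flip: exp_of_nat_mult)
  also have "\<dots> \<le> inverse (1 + 1 / real m) ^ m"
    by (intro power_mono le_imp_inverse_le exp_ge_add_one_self) (auto simp: add_pos_nonneg)
  also have "inverse (1 + 1 / real m) = 1 - 1 / real n"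
    using m by (simp add: field_simps)
  finally show ?thesis
    by (simp add: m_def)
qed simp

lemma norm_diff_other_root_ge:
  assumes "p \<noteq> 0" "poly p v = 0" "v \<noteq> z" "\<delta> \<ge> 0" "cmod (w - z) \<le> \<delta> * separation z p"
  shows "(1 - \<delta>) * cmod (z - v) \<le> cmod (w - v)"
proof -
  have "cmod (w - z) \<le> \<delta> * cmod (z - v)"
    using assms by (meson mult_left_mono order_trans separation_le)
  moreover have "cmod (z - v) \<le> cmod (w - z) + cmod (w - v)"
    using norm_triangle_ineq4[of "w - v" "w - z"] by simp
  ultimately show ?thesis
    by (simp add: algebra_simps)
qed

lemma norm_poly_ge_near_root:
  fixes p :: "complex poly"
  assumes p: "rsquarefree p" and z: "poly p z = 0"
    and w: "cmod (w - z) \<le> separation z p / real (degree p)"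
  shows "cmod (w - z) * cmod (poly (pderiv p) z) \<le> exp 1 * cmod (poly p w)"
proof -
  define n where "n = degree p"
  define R where "R = {v. poly p v = 0} - {z}"
  have "p \<noteq> 0"
    using p by (simp add: rsquarefree_def)
  then have fin: "finite {v. poly p v = 0}"
    by (rule poly_roots_finite)
  have "card {v. poly p v = 0} = n"
    by (simp add: n_def card_roots_rsquarefree[OF p])
  then have "n > 0" and card: "card R = n - 1"
    using z fin by (auto simp: R_def card_gt_0_iff)
  have factor: "(1 - 1 / real n) * cmod (z - v) \<le> cmod (w - v)" if "v \<in> R" for v
    using that w \<open>p \<noteq> 0\<close> by (intro norm_diff_other_root_ge) (auto simp: R_def n_def)
  have "exp (- 1) * (\<Prod>v\<in>R. cmod (z - v)) \<le> (1 - 1 / real n) ^ (n - 1) * (\<Prod>v\<in>R. cmod (z - v))"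
    using \<open>n > 0\<close> by (intro mult_right_mono one_minus_inverse_power_ge prod_nonneg) auto
  also have "\<dots> = (\<Prod>v\<in>R. (1 - 1 / real n) * cmod (z - v))"
    by (simp add: prod.distrib card)
  also have "\<dots> \<le> (\<Prod>v\<in>R. cmod (w - v))"
    using factor \<open>n > 0\<close> by (intro prod_mono) auto
  finally have "(\<Prod>v\<in>R. cmod (z - v)) \<le> exp 1 * (\<Prod>v\<in>R. cmod (w - v))"
    by (simp add: exp_minus field_simps)
  then have "cmod (lead_coeff p) * cmod (w - z) * (\<Prod>v\<in>R. cmod (z - v))
      \<le> cmod (lead_coeff p) * cmod (w - z) * (exp 1 * (\<Prod>v\<in>R. cmod (w - v)))"
    by (intro mult_left_mono) auto
  moreover have "poly p w = lead_coeff p * (w - z) * (\<Prod>v\<in>R. w - v)"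
    using z fin by (simp add: poly_rsquarefree_eq_prod[OF p, of w] R_def prod.remove[of _ z])
  ultimately show ?thesis
    by (simp add: poly_pderiv_rsquarefree_root[OF p z] norm_mult mult_ac flip: R_def prod_norm)
qed

section \<open>Minimum modulus and perturbation\<close>

lemma minimum_modulus_frontier:
  assumes "bounded S" and hol: "f holomorphic_on interior S" and cont: "continuous_on (closure S) f"
    and nz: "\<And>w. w \<in> closure S \<Longrightarrow> f w \<noteq> 0"
    and B: "0 < B" "\<And>w. w \<in> frontier S \<Longrightarrow> B \<le> cmod (f w)" and "w \<in> S"
  shows "B \<le> cmod (f w)"
proof -
  have "cmod (inverse (f w)) \<le> inverse B"
  proof (rule maximum_modulus_frontier[where f = "\<lambda>w. inverse (f w)" and S = S])
    show "(\<lambda>w. inverse (f w)) holomorphic_on interior S"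
      using nz hol interior_subset[of S] closure_subset[of S] by (intro holomorphic_on_inverse) auto
    show "continuous_on (closure S) (\<lambda>w. inverse (f w))"
      using nz cont by (intro continuous_on_inverse) auto
    show "cmod (inverse (f v)) \<le> inverse B" if "v \<in> frontier S" for v
      using that B by (simp add: norm_inverse le_imp_inverse_le)
  qed fact+
  moreover have "f w \<noteq> 0"
    using nz \<open>w \<in> S\<close> closure_subset by blast
  ultimately show ?thesis
    using B(1) by (simp add: norm_inverse)
qed

lemma poly_minimum_modulus_outside:
  fixes p :: "complex poly"
  assumes "degree p > 0" "open U" and roots: "{z. poly p z = 0} \<subseteq> U"
    and B: "0 < B" "\<And>w. w \<in> frontier U \<Longrightarrow> B \<le> cmod (poly p w)" and "w \<notin> U"
  shows "B \<le> cmod (poly p w)"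
proof -
  obtain a q where p: "p = pCons a q"
    by (cases p)
  with \<open>degree p > 0\<close> have "q \<noteq> 0"
    by auto
  then obtain M where M: "\<And>v. M \<le> cmod v \<Longrightarrow> B \<le> cmod (poly p v)"
    using poly_infinity[of q B a] p by blast
  define D where "D = cball (0::complex) (max M (cmod w))"
  show ?thesis
  proof (rule minimum_modulus_frontier[where f = "poly p" and S = "D - U"])
    show "bounded (D - U)"
      by (auto simp: D_def intro: bounded_subset)
    have "closed (D - U)"
      using \<open>open U\<close> by (auto simp: D_def)
    then show "poly p v \<noteq> 0" if "v \<in> closure (D - U)" for v
      using that roots by auto
    show "poly p holomorphic_on interior (D - U)"
      by (intro holomorphic_intros)
    show "continuous_on (closure (D - U)) (poly p)"
      by (intro continuous_intros)
    show "B \<le> cmod (poly p v)" if "v \<in> frontier (D - U)" for v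
    proof -
      have "frontier (D - U) \<subseteq> frontier D \<union> frontier U"
        using frontier_Int_subset[of D "- U"] by (simp add: Diff_eq)
      with that have "v \<in> sphere 0 (max M (cmod w)) \<or> v \<in> frontier U"
        by (auto simp: D_def)
      then show ?thesis
        using B(2) M by auto
    qed
    show "w \<in> D - U"
      using \<open>w \<notin> U\<close> by (simp add: D_def)
  qed fact
qed

lemma norm_poly_diff_approx_polys_le:
  assumes "g \<in> approx_polys f \<mu>"
  shows "cmod (poly f w - poly g w) \<le> \<mu> * (\<Sum>k\<le>degree f. cmod w ^ k)"
proof -
  have deg: "degree (f - g) \<le> degree f"
    using assms by (auto simp: approx_polys_def intro: degree_diff_le)
  have "poly f w - poly g w = (\<Sum>k\<le>degree f. coeff (f - g) k * w ^ k)"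
    unfolding poly_diff[symmetric] poly_altdef[of "f - g"] using deg
    by (intro sum.mono_neutral_left) (auto simp: coeff_eq_0 simp del: coeff_diff)
  also have "cmod \<dots> \<le> (\<Sum>k\<le>degree f. \<mu> * cmod w ^ k)"
    using assms by (intro order_trans[OF norm_sum] sum_mono)
      (auto simp: approx_polys_def norm_mult norm_power intro!: mult_right_mono)
  finally show ?thesis
    by (simp add: sum_distrib_left)
qed

section \<open>Isolating discs of simple roots\<close>

locale isolating_discs =
  fixes f :: "complex poly" and t :: real
  assumes rsquarefree_f: "rsquarefree f" and degree_ge_2: "degree f \<ge> 2" and t_ge_1: "t \<ge> 1"
begin

definition radius :: "complex \<Rightarrow> real" where
  "radius z = separation z f / (t * real (degree f))"

definition disc :: "complex \<Rightarrow> complex set" where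
  "disc z = ball z (radius z)"

lemma f_nonzero: "f \<noteq> 0"
  using rsquarefree_f by (simp add: rsquarefree_def)

lemma finite_roots: "finite {z. poly f z = 0}"
  using f_nonzero by (rule poly_roots_finite)

lemma ex_other_root: "\<exists>w. poly f w = 0 \<and> w \<noteq> z"
proof (rule ccontr)
  assume "\<not> ?thesis"
  then have "{w. poly f w = 0} \<subseteq> {z}"
    by blast
  then have "degree f \<le> 1"
    using card_mono[of "{z}" "{w. poly f w = 0}"] card_roots_rsquarefree[OF rsquarefree_f] by simp
  with degree_ge_2 show False
    by simp
qed

lemma separation_f_pos: "separation z f > 0"
  using ex_other_root[of z] separation_pos[OF f_nonzero] by blast

lemma radius_pos: "radius z > 0"
  using separation_f_pos t_ge_1 degree_ge_2 by (simp add: radius_def)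

lemma radius_le_separation_div_degree: "radius z \<le> separation z f / real (degree f)"
  using separation_f_pos[of z] t_ge_1 degree_ge_2
  by (auto simp: radius_def intro!: divide_left_mono)

lemma radius_le_half_separation: "radius z \<le> separation z f / 2"
proof -
  have "separation z f / real (degree f) \<le> separation z f / 2"
    using separation_f_pos[of z] degree_ge_2 by (intro divide_left_mono) auto
  with radius_le_separation_div_degree[of z] show ?thesis
    by linarith
qed

lemma centre_in_disc: "z \<in> disc z"
  using radius_pos by (simp add: disc_def)

lemma disc_disjoint:
  assumes "poly f z = 0" "poly f w = 0" "z \<noteq> w"
  shows "disc z \<inter> disc w = {}"
proof -
  have "separation z f \<le> dist z w" "separation w f \<le> dist z w"
    using separation_le[OF f_nonzero, of w z] separation_le[OF f_nonzero, of z w] assms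
    by (simp_all add: dist_norm norm_minus_commute)
  then show ?thesis
    unfolding disc_def using radius_le_half_separation[of z] radius_le_half_separation[of w]
    by (intro disjoint_ballI) linarith
qed

lemma mu_pos: "mu f t > 0"
proof -
  have "poly (pderiv f) z \<noteq> 0" if "poly f z = 0" for z
    using that rsquarefree_f by (auto simp: rsquarefree_roots)
  moreover have "separation z f \<noteq> 0" for z
    using separation_f_pos[of z] by simp
  ultimately have "0 < Min {cmod (of_real (separation z f) * poly (pderiv f) z /
      of_nat (8 * (degree f)\<^sup>2)) | z. poly f z = 0}"
    using finite_roots ex_other_root[of 0] degree_ge_2 by (subst Min_gr_iff) auto
  then show ?thesis
    unfolding mu_def using t_ge_1 by (intro mult_pos_pos) auto
qed

lemma mu_le_radius_mult_norm_pderiv: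
  assumes "poly f z = 0"
  shows "8 * real (degree f) * mu f t \<le> radius z * cmod (poly (pderiv f) z)"
proof -
  have "t * mu f t \<le> cmod (separation z f * poly (pderiv f) z / of_nat (8 * (degree f)\<^sup>2))"
    unfolding mu_def using t_ge_1 finite_roots assms by (simp, intro Min_le) auto
  also have "\<dots> = separation z f * cmod (poly (pderiv f) z) / (8 * (real (degree f))\<^sup>2)"
    using separation_f_pos[of z] by (simp add: norm_mult norm_divide norm_power)
  finally show ?thesis
    using t_ge_1 degree_ge_2 by (simp add: radius_def field_simps power2_eq_square)
qed

lemma norm_poly_ge_on_circle:
  assumes "poly f z = 0" "w \<in> sphere z (radius z)"
  shows "8 / 3 * real (degree f) * mu f t \<le> cmod (poly f w)"
proof -
  have w: "cmod (w - z) = radius z"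
    using assms(2) by (simp add: dist_norm norm_minus_commute)
  have "8 * real (degree f) * mu f t \<le> radius z * cmod (poly (pderiv f) z)"
    by (rule mu_le_radius_mult_norm_pderiv) fact
  also have "\<dots> \<le> exp 1 * cmod (poly f w)"
    using norm_poly_ge_near_root[OF rsquarefree_f assms(1), of w] radius_le_separation_div_degree[of z]
    by (simp add: w)
  also have "\<dots> \<le> 3 * cmod (poly f w)"
    by (intro mult_right_mono exp_le) auto
  finally show ?thesis
    by simp
qed

lemma norm_poly_gt_outside_discs:
  assumes "w \<notin> (\<Union>z \<in> {z. poly f z = 0}. disc z)"
  shows "(real (degree f) + 1) * mu f t < cmod (poly f w)"
proof -
  let ?U = "\<Union>z \<in> {z. poly f z = 0}. disc z"
  have "(real (degree f) + 1) * mu f t < 8 / 3 * real (degree f) * mu f t"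
    using degree_ge_2 mu_pos by (intro mult_strict_right_mono) auto
  also have "\<dots> \<le> cmod (poly f w)"
  proof (rule poly_minimum_modulus_outside)
    show "open ?U"
      by (auto simp: disc_def)
    show "{z. poly f z = 0} \<subseteq> ?U"
      using centre_in_disc by blast
    fix v assume "v \<in> frontier ?U"
    moreover have "frontier ?U \<subseteq> (\<Union>z \<in> {z. poly f z = 0}. sphere z (radius z))"
      using frontier_Union_subset[of "disc ` {z. poly f z = 0}"] finite_roots radius_pos
      by (auto simp: disc_def)
    ultimately show "8 / 3 * real (degree f) * mu f t \<le> cmod (poly f v)"
      using norm_poly_ge_on_circle by blast
  qed (use assms degree_ge_2 mu_pos in auto)
  finally show ?thesis .
qed

context
  fixes g :: "complex poly"
  assumes roots_le_half: "\<And>z. poly f z = 0 \<Longrightarrow> cmod z \<le> 1 / 2"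
    and approx: "g \<in> approx_polys f (mu f t)"
begin

lemma radius_le_half:
  assumes "poly f z = 0"
  shows "radius z \<le> 1 / 2"
proof -
  obtain w where w: "poly f w = 0" "w \<noteq> z"
    using ex_other_root by blast
  then have "separation z f \<le> cmod (z - w)"
    by (intro separation_le f_nonzero)
  also have "\<dots> \<le> cmod z + cmod w"
    by (rule norm_triangle_ineq4)
  also have "\<dots> \<le> 1"
    using roots_le_half[OF assms] roots_le_half[OF w(1)] by simp
  finally show ?thesis
    using radius_le_half_separation[of z] by simp
qed

lemma norm_perturbed_poly_gt_on_circle:
  assumes z: "poly f z = 0" and w: "w \<in> sphere z (radius z)"
  shows "2 * mu f t < cmod (poly g w)"
proof -
  have "cmod w \<le> cmod z + dist z w"
    using norm_triangle_ineq[of z "w - z"] by (simp add: dist_norm norm_minus_commute)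
  also have "\<dots> \<le> 1"
    using w radius_le_half[OF z] roots_le_half[OF z] by simp
  finally have "(\<Sum>k\<le>degree f. cmod w ^ k) \<le> (\<Sum>k\<le>degree f. 1)"
    by (intro sum_mono power_le_one) auto
  then have "cmod (poly f w - poly g w) \<le> mu f t * (real (degree f) + 1)"
    using norm_poly_diff_approx_polys_le[OF approx, of w] mu_pos
    by (auto intro: order_trans mult_left_mono)
  moreover have "cmod (poly f w) \<le> cmod (poly f w - poly g w) + cmod (poly g w)"
    using norm_triangle_ineq[of "poly f w - poly g w" "poly g w"] by simp
  moreover have "8 / 3 * real (degree f) * mu f t \<le> cmod (poly f w)"
    by (rule norm_poly_ge_on_circle) fact+
  moreover have "(real (degree f) + 3) * mu f t < 8 / 3 * real (degree f) * mu f t"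
    using degree_ge_2 mu_pos by (intro mult_strict_right_mono) auto
  ultimately show ?thesis
    by (simp add: algebra_simps)
qed

lemma norm_perturbed_poly_root_le:
  assumes "poly f z = 0"
  shows "cmod (poly g z) \<le> 2 * mu f t"
proof -
  have "1 / 2 * (\<Sum>k\<le>degree f. cmod z ^ k) \<le> (1 - cmod z) * (\<Sum>k\<le>degree f. cmod z ^ k)"
    using roots_le_half[OF assms] by (intro mult_right_mono sum_nonneg) auto
  also have "\<dots> \<le> 1"
    by (subst sum_gp_basic) simp
  finally have "mu f t * (\<Sum>k\<le>degree f. cmod z ^ k) \<le> mu f t * 2"
    using mu_pos by (intro mult_left_mono) auto
  then show ?thesis
    using norm_poly_diff_approx_polys_le[OF approx, of z] assms by simp
qed

lemma perturbed_root_in_disc: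
  assumes "poly f z = 0"
  shows "\<exists>w \<in> disc z. poly g w = 0"
proof (rule holomorphic_contract_to_zero)
  show "continuous_on (cball z (radius z)) (poly g)"
    by (intro continuous_intros)
  show "poly g holomorphic_on ball z (radius z)"
    by (intro holomorphic_intros)
  show "radius z > 0"
    by (rule radius_pos)
  show "cmod (poly g z) < cmod (poly g w)" if "cmod (z - w) = radius z" for w
    using norm_perturbed_poly_root_le[OF assms] norm_perturbed_poly_gt_on_circle[OF assms, of w] that
    by (simp add: dist_norm)
qed (auto simp: disc_def)

lemma perturbed_poly_nonzero: "g \<noteq> 0"
proof
  assume "g = 0"
  obtain z where "poly f z = 0"
    using ex_other_root by blast
  moreover have "z + of_real (radius z) \<in> sphere z (radius z)"
    using radius_pos[of z] by (simp add: dist_norm)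
  ultimately have "2 * mu f t < cmod (poly g (z + of_real (radius z)))"
    by (rule norm_perturbed_poly_gt_on_circle)
  with \<open>g = 0\<close> mu_pos show False
    by simp
qed

lemma ex_bij_betw_perturbed_roots:
  "\<exists>h. bij_betw h {z. poly f z = 0} {w. poly g w = 0} \<and> (\<forall>z. poly f z = 0 \<longrightarrow> h z \<in> disc z)"
proof -
  obtain h where h: "\<And>z. poly f z = 0 \<Longrightarrow> h z \<in> disc z \<and> poly g (h z) = 0"
    using perturbed_root_in_disc by metis
  have inj: "inj_on h {z. poly f z = 0}"
  proof (rule inj_onI, rule ccontr)
    fix z w assume zw: "z \<in> {z. poly f z = 0}" "w \<in> {z. poly f z = 0}" "h z = h w" "z \<noteq> w"
    then have "h z \<in> disc z \<inter> disc w"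
      using h[of z] h[of w] by simp
    with zw disc_disjoint[of z w] show False
      by simp
  qed
  have "card {w. poly g w = 0} \<le> degree f"
    using card_poly_roots_bound[OF perturbed_poly_nonzero] approx by (simp add: approx_polys_def)
  then have "card {w. poly g w = 0} \<le> card (h ` {z. poly f z = 0})"
    by (simp add: card_image[OF inj] card_roots_rsquarefree[OF rsquarefree_f])
  then have "h ` {z. poly f z = 0} = {w. poly g w = 0}"
    using h poly_roots_finite[OF perturbed_poly_nonzero] by (intro card_seteq) auto
  with inj h show ?thesis
    by (auto simp: bij_betw_def)
qed

end

end

section \<open>The scaled polynomial\<close>

lemma scaled_poly_altdef:
  "scaled_poly F \<Gamma> = smult (of_real (1 / lead_coeff F))
     (pcompose (map_poly complex_of_real F) [:0, 2 powi (\<Gamma> + 1):])"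
  unfolding scaled_poly_def
  by (intro poly_eqI) (simp add: coeff_map_poly coeff_pcompose_linear)

lemma rsquarefree_scaled_poly:
  assumes "squarefree F"
  shows "rsquarefree (scaled_poly F \<Gamma>)"
proof -
  have "F \<noteq> 0"
    using assms by auto
  then show ?thesis
    unfolding scaled_poly_altdef using squarefree_imp_rsquarefree_map_poly_of_real[OF assms]
    by (intro rsquarefree_smult_pcompose_linear) auto
qed

lemma degree_scaled_poly: "degree (scaled_poly F \<Gamma>) = degree F"
  by (cases "F = 0") (simp_all add: scaled_poly_altdef degree_pcompose degree_map_poly)

lemma roots_scaled_poly:
  assumes "F \<noteq> 0"
  shows "{x. poly (scaled_poly F \<Gamma>) x = 0}
    = (\<lambda>\<xi>. \<xi> / 2 powi (\<Gamma> + 1)) ` {\<xi>. poly (map_poly complex_of_real F) \<xi> = 0}"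
  using assms by (force simp: scaled_poly_altdef poly_pcompose image_iff)

lemma bij_betw_roots_scaled_poly:
  assumes F: "squarefree F" and A: "finite A" "card A = degree F"
    and factorization: "map_poly complex_of_real F = smult c (\<Prod>i\<in>A. [:- \<xi> i, 1:])"
    and z: "\<And>i. i \<in> A \<Longrightarrow> z i = \<xi> i / 2 powi (\<Gamma> + 1)"
  shows "bij_betw z A {w. poly (scaled_poly F \<Gamma>) w = 0}"
proof -
  have "F \<noteq> 0"
    using F by auto
  then have "c \<noteq> 0"
    using factorization by (auto simp: map_poly_eq_0_iff)
  then have "{x. poly (map_poly complex_of_real F) x = 0} = \<xi> ` A"
    using A(1) by (auto simp: factorization poly_prod)
  then have "z ` A = {w. poly (scaled_poly F \<Gamma>) w = 0}"
    using z by (simp add: roots_scaled_poly[OF \<open>F \<noteq> 0\<close>] image_image)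
  moreover have "card {w. poly (scaled_poly F \<Gamma>) w = 0} = card A"
    using A(2) by (simp add: card_roots_rsquarefree rsquarefree_scaled_poly[OF F] degree_scaled_poly)
  ultimately show ?thesis
    using A(1) by (simp add: bij_betw_def eq_card_imp_inj_on)
qed

lemma norm_scaled_root_le_half:
  assumes "finite A" "i \<in> A" "log 2 (Max ((\<lambda>i. cmod (\<xi> i)) ` A)) \<le> of_int \<Gamma>"
  shows "cmod (\<xi> i / 2 powi (\<Gamma> + 1)) \<le> 1 / 2"
proof (cases "\<xi> i = 0")
  case False
  have le: "cmod (\<xi> i) \<le> Max ((\<lambda>i. cmod (\<xi> i)) ` A)"
    using assms by (intro Max_ge) auto
  moreover from False have "0 < cmod (\<xi> i)"
    by simp
  ultimately have "0 < Max ((\<lambda>i. cmod (\<xi> i)) ` A)"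
    by linarith
  then have "Max ((\<lambda>i. cmod (\<xi> i)) ` A) \<le> 2 powr of_int \<Gamma>"
    using assms(3) by (simp add: log_le_iff)
  with le have "cmod (\<xi> i) \<le> 2 powi \<Gamma>"
    by (simp add: powr_real_of_int')
  then show ?thesis
    by (simp add: norm_divide norm_power_int power_int_add divide_simps)
qed simp

theorem theorem3:
  fixes F :: "real poly" and n :: nat and \<xi> z :: "nat \<Rightarrow> complex"
    and \<Gamma> :: int and \<Gamma>\<^sub>F t :: real and f ft :: "complex poly" and \<Delta> :: "nat \<Rightarrow> complex set"
  assumes "degree F = n" and "n \<ge> 2" and "squarefree F" and "\<bar>lead_coeff F\<bar> \<ge> 1"
    and "map_poly complex_of_real F =
           smult (complex_of_real (lead_coeff F)) (\<Prod>i=1..n. [:- \<xi> i, 1:])"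
    and "\<Gamma>\<^sub>F = log 2 (Max ((\<lambda>i. cmod (\<xi> i)) ` {1..n}))"
    and "\<Gamma>\<^sub>F \<le> of_int \<Gamma>" and "of_int \<Gamma> < 4 * log 2 (real n) + \<Gamma>\<^sub>F"
    and "f = scaled_poly F \<Gamma>"
    and "\<And>i. i \<in> {1..n} \<Longrightarrow> z i = \<xi> i / 2 powi (\<Gamma> + 1)"
    and "t \<ge> 1"
    and "ft \<in> approx_polys f (mu f t)"
    and "\<And>i. i \<in> {1..n} \<Longrightarrow> \<Delta> i = ball (z i) (separation (z i) f / (t * real n))"
  shows "(\<exists>zt. bij_betw zt {1..n} {w. poly ft w = 0} \<and>
            (\<forall>i\<in>{1..n}. poly f (z i) = 0 \<and> z i \<in> \<Delta> i \<and> zt i \<in> \<Delta> i)) \<and>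
         (\<forall>w. w \<notin> (\<Union>i\<in>{1..n}. \<Delta> i) \<longrightarrow> cmod (poly f w) > (real n + 1) * mu f t)"
proof -
  have degree_f: "degree f = n"
    by (simp add: assms(9) degree_scaled_poly assms(1))
  interpret isolating_discs f t
    using assms(2,3,9,11) rsquarefree_scaled_poly degree_f by unfold_locales auto
  have bij_z: "bij_betw z {1..n} {w. poly f w = 0}"
    unfolding assms(9) using assms(1,10)
    by (intro bij_betw_roots_scaled_poly[OF assms(3) _ _ assms(5)]) auto
  then have roots: "{w. poly f w = 0} = z ` {1..n}"
    by (simp add: bij_betw_def)
  have small: "cmod w \<le> 1 / 2" if "w \<in> {w. poly f w = 0}" for w
    using that norm_scaled_root_le_half[of "{1..n}" _ \<xi> \<Gamma>] assms(6,7)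
    unfolding roots by (auto simp: assms(10))
  obtain h where h: "bij_betw h {w. poly f w = 0} {w. poly ft w = 0}"
    "\<And>w. poly f w = 0 \<Longrightarrow> h w \<in> disc w"
    using ex_bij_betw_perturbed_roots[OF small[OF CollectI] assms(12)] by blast
  have \<Delta>: "\<Delta> i = disc (z i)" if "i \<in> {1..n}" for i
    using that by (simp add: assms(13) disc_def radius_def degree_f)
  have "bij_betw (h \<circ> z) {1..n} {w. poly ft w = 0}"
    by (rule bij_betw_trans) fact+
  moreover have "\<forall>i\<in>{1..n}. poly f (z i) = 0 \<and> z i \<in> \<Delta> i \<and> (h \<circ> z) i \<in> \<Delta> i"
    using bij_betwE[OF bij_z] h(2) centre_in_disc \<Delta> by simp
  moreover have "(\<Union>i\<in>{1..n}. \<Delta> i) = (\<Union>w \<in> {w. poly f w = 0}. disc w)"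
    by (simp add: roots \<Delta>)
  ultimately show ?thesis
    using norm_poly_gt_outside_discs degree_f by auto
qed

end
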